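(* For any $q<\tfrac32$, there exists a set of Jacobi parameters $\{a_n,b_n\}_{n=1}^\infty$ ($a_n>0$, $b_n\in\mathbb{R}$) such that $(\alpha)$ $\sum_{n=1}^\infty\bigl(|a_n-1|^2+|b_n|^2\bigr)<\infty$, $(\beta)$ $\lim_{n\to\infty}a_1\cdots a_n$ exists (finite) and is not zero, $(\gamma)$ $\lim_{n\to\infty}\sum_{j=1}^nb_j$ exists (finite), and such that $$\sum_{j,\pm}\bigl(|E_j^\pm|-2\bigr)^q=\infty.$$
   Context: The Jacobi matrix $J$ with parameters $\{a_n,b_n\}$ is the bounded selfadjoint operator on $\ell^2(\{1,2,\dots\})$ given by the tridiagonal matrix with $J_{nn}=b_n$ and $J_{n,n+1}=J_{n+1,n}=a_n$. When $a_n\to1$, $b_n\to0$, its spectrum outside $[-2,2]$ consists of isolated simple eigenvalues; $\{E_j^+\}$ are the eigenvalues in $(2,\infty)$ and $\{E_j^-\}$ those in $(-\infty,-2)$. The sum runs over all of these eigenvalues. *)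

theory Defs
  imports "HOL-Analysis.Analysis"
begin

text \<open>
  Sites are numbered from 1. A vector of $\ell^2(\{1,2,\dots\})$ is represented by a function on
  the naturals that vanishes at the dummy site 0, so that equality of vectors is equality of
  functions. The values of \<open>a\<close> and \<open>b\<close> at 0 are never used.
\<close>

definition ell2 :: "(nat \<Rightarrow> complex) set" where
  "ell2 = {u. u 0 = 0 \<and> summable (\<lambda>n. (cmod (u n))\<^sup>2)}"

definition ell2_inner :: "(nat \<Rightarrow> complex) \<Rightarrow> (nat \<Rightarrow> complex) \<Rightarrow> complex" where
  "ell2_inner u v = (\<Sum>n. cnj (u n) * v n)"

definition ell2_norm :: "(nat \<Rightarrow> complex) \<Rightarrow> real" where
  "ell2_norm u = sqrt (\<Sum>n. (cmod (u n))\<^sup>2)"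

definition jacobi_matrix :: "(nat \<Rightarrow> real) \<Rightarrow> (nat \<Rightarrow> real) \<Rightarrow> nat \<Rightarrow> nat \<Rightarrow> real" where
  "jacobi_matrix a b m n =
     (if m = n then b n else if n = m + 1 then a m else if m = n + 1 then a n else 0)"

definition jacobi_op ::
    "(nat \<Rightarrow> real) \<Rightarrow> (nat \<Rightarrow> real) \<Rightarrow> (nat \<Rightarrow> complex) \<Rightarrow> nat \<Rightarrow> complex" where
  "jacobi_op a b u m =
     (if m = 0 then 0 else \<Sum>\<^sub>\<infinity>n\<in>{1..}. complex_of_real (jacobi_matrix a b m n) * u n)"

definition jacobi_eigenvalue :: "(nat \<Rightarrow> real) \<Rightarrow> (nat \<Rightarrow> real) \<Rightarrow> complex \<Rightarrow> bool" where
  "jacobi_eigenvalue a b z \<longleftrightarrow>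
     (\<exists>u\<in>ell2. u \<noteq> (\<lambda>n. 0) \<and> jacobi_op a b u = (\<lambda>n. z * u n))"

text \<open>
  The eigenvalues $E_j^+$ and $E_j^-$, as sets of reals. By \<open>jacobi_eigenvalue_simple\<close> below each
  eigenvalue is simple, so a sum over these sets counts multiplicities correctly.
\<close>

definition eigs_plus :: "(nat \<Rightarrow> real) \<Rightarrow> (nat \<Rightarrow> real) \<Rightarrow> real set" where
  "eigs_plus a b = {E. jacobi_eigenvalue a b (complex_of_real E) \<and> E > 2}"

definition eigs_minus :: "(nat \<Rightarrow> real) \<Rightarrow> (nat \<Rightarrow> real) \<Rightarrow> real set" where
  "eigs_minus a b = {E. jacobi_eigenvalue a b (complex_of_real E) \<and> E < - 2}"

lemma jacobi_op_0 [simp]: "jacobi_op a b u 0 = 0"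
  by (simp add: jacobi_op_def)

lemma jacobi_op_Suc:
  assumes "u 0 = 0"
  shows "jacobi_op a b u (Suc k) = a k * u k + b (Suc k) * u (Suc k) + a (Suc k) * u (Suc (Suc k))"
proof -
  let ?f = "\<lambda>n. complex_of_real (jacobi_matrix a b (Suc k) n) * u n"
  have "(\<Sum>\<^sub>\<infinity>n\<in>{1..}. ?f n) = (\<Sum>\<^sub>\<infinity>n\<in>{k, Suc k, Suc (Suc k)}. ?f n)"
    by (rule infsum_cong_neutral) (use assms in \<open>auto simp: jacobi_matrix_def not_le\<close>)
  also have "\<dots> = (\<Sum>n\<in>{k, Suc k, Suc (Suc k)}. ?f n)"
    by (rule infsum_finite) simp
  also have "\<dots> = a k * u k + b (Suc k) * u (Suc k) + a (Suc k) * u (Suc (Suc k))"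
    by (simp add: jacobi_matrix_def)
  finally show ?thesis
    by (simp add: jacobi_op_def)
qed

lemma jacobi_eigenvalue_simple:
  assumes a: "\<forall>n\<ge>1. a n > 0"
    and u: "u \<in> ell2" "u \<noteq> (\<lambda>n. 0)" "jacobi_op a b u = (\<lambda>n. z * u n)"
    and v: "v \<in> ell2" "jacobi_op a b v = (\<lambda>n. z * v n)"
  shows "\<exists>c. v = (\<lambda>n. c * u n)"
proof -
  have rec: "w (Suc (Suc k)) = ((z - b (Suc k)) * w (Suc k) - a k * w k) / a (Suc k)"
    if "w \<in> ell2" "jacobi_op a b w = (\<lambda>n. z * w n)" for w :: "nat \<Rightarrow> complex" and k
  proof -
    have "a (Suc k) \<noteq> 0"
      using a by (metis less_irrefl One_nat_def Suc_le_mono le0)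
    moreover have "z * w (Suc k) = a k * w k + b (Suc k) * w (Suc k) + a (Suc k) * w (Suc (Suc k))"
      using jacobi_op_Suc[of w a b k] that by (simp add: ell2_def)
    ultimately show ?thesis
      by (simp add: field_simps)
  qed
  have zero: "u 0 = 0" "v 0 = 0"
    using u v by (auto simp: ell2_def)
  have "u 1 \<noteq> 0"
  proof
    assume u1: "u 1 = 0"
    have "u n = 0 \<and> u (Suc n) = 0" for n
      by (induction n) (use zero u1 rec[OF u(1,3)] in auto)
    then show False
      using u(2) by auto
  qed
  define c where "c = v 1 / u 1"
  have "v n = c * u n \<and> v (Suc n) = c * u (Suc n)" for n
  proof (induction n)
    case 0
    then show ?case
      using zero \<open>u 1 \<noteq> 0\<close> by (simp add: c_def)
  next
    case (Suc n)
    then show ?case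
      by (auto simp: rec[OF u(1,3)] rec[OF v] diff_divide_distrib algebra_simps)
  qed
  then show ?thesis
    by blast
qed

text \<open>
  For bounded parameters, in particular under square summability of $a_n - 1$ and $b_n$,
  \<open>jacobi_op\<close> maps \<open>ell2\<close> to itself and is a bounded, everywhere defined symmetric (hence
  selfadjoint) operator.
\<close>

lemma jacobi_op_bounded_aux:
  assumes C: "\<And>n. n \<ge> 1 \<Longrightarrow> \<bar>a n\<bar> \<le> C" "\<And>n. n \<ge> 1 \<Longrightarrow> \<bar>b n\<bar> \<le> C" and u: "u \<in> ell2"
  shows "jacobi_op a b u \<in> ell2 \<and> ell2_norm (jacobi_op a b u) \<le> 3 * C * ell2_norm u"
proof -
  have C0: "C \<ge> 0"
    using C(1)[of 1] by linarith
  have u0: "u 0 = 0" and su: "summable (\<lambda>n. (cmod (u n))\<^sup>2)"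
    using u by (auto simp: ell2_def)
  have su1: "summable (\<lambda>n. (cmod (u (Suc n)))\<^sup>2)"
    using su by (subst summable_Suc_iff)
  have su2: "summable (\<lambda>n. (cmod (u (Suc (Suc n))))\<^sup>2)"
    using su1 by (subst summable_Suc_iff[of "\<lambda>n. (cmod (u (Suc n)))\<^sup>2"])
  define S where "S = (\<Sum>n. (cmod (u n))\<^sup>2)"
  have S1: "(\<Sum>n. (cmod (u (Suc n)))\<^sup>2) = S"
    using suminf_split_head[OF su] u0 by (simp add: S_def)
  have S2: "(\<Sum>n. (cmod (u (Suc (Suc n))))\<^sup>2) \<le> S"
    using suminf_split_head[OF su1] S1 by simp
  let ?g = "\<lambda>k. 3 * C\<^sup>2 * ((cmod (u k))\<^sup>2 + (cmod (u (Suc k)))\<^sup>2 + (cmod (u (Suc (Suc k))))\<^sup>2)"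
  have bd: "(cmod (jacobi_op a b u (Suc k)))\<^sup>2 \<le> ?g k" for k
  proof -
    let ?x = "cmod (u k)" and ?y = "cmod (u (Suc k))" and ?z = "cmod (u (Suc (Suc k)))"
    have x: "cmod (a k * u k) \<le> C * ?x"
      using u0 C(1)[of k] by (cases "k = 0") (auto simp: norm_mult intro!: mult_right_mono)
    have y: "cmod (b (Suc k) * u (Suc k)) \<le> C * ?y"
      using C(2)[of "Suc k"] by (auto simp: norm_mult intro!: mult_right_mono)
    have z: "cmod (a (Suc k) * u (Suc (Suc k))) \<le> C * ?z"
      using C(1)[of "Suc k"] by (auto simp: norm_mult intro!: mult_right_mono)
    have "cmod (jacobi_op a b u (Suc k)) \<le> C * ?x + C * ?y + C * ?z"
      unfolding jacobi_op_Suc[of u, OF u0] by (intro norm_triangle_mono x y z)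
    then have "(cmod (jacobi_op a b u (Suc k)))\<^sup>2 \<le> (C * ?x + C * ?y + C * ?z)\<^sup>2"
      by (intro power_mono) auto
    also have "\<dots> = C\<^sup>2 * (?x + ?y + ?z)\<^sup>2"
      by (simp add: power_mult_distrib[symmetric] distrib_left)
    also have "\<dots> \<le> C\<^sup>2 * (3 * (?x\<^sup>2 + ?y\<^sup>2 + ?z\<^sup>2))"
    proof (intro mult_left_mono)
      have "3 * (?x\<^sup>2 + ?y\<^sup>2 + ?z\<^sup>2) - (?x + ?y + ?z)\<^sup>2 = (?x - ?y)\<^sup>2 + (?y - ?z)\<^sup>2 + (?x - ?z)\<^sup>2"
        by (simp add: power2_eq_square algebra_simps)
      then show "(?x + ?y + ?z)\<^sup>2 \<le> 3 * (?x\<^sup>2 + ?y\<^sup>2 + ?z\<^sup>2)"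
        by (smt (verit) zero_le_power2)
    qed simp
    finally show ?thesis
      by (simp add: algebra_simps)
  qed
  have sg: "summable ?g"
    by (intro summable_mult summable_add su su1 su2)
  have sJ1: "summable (\<lambda>k. (cmod (jacobi_op a b u (Suc k)))\<^sup>2)"
    by (rule summable_comparison_test'[OF sg]) (use bd in auto)
  then have sJ: "summable (\<lambda>k. (cmod (jacobi_op a b u k))\<^sup>2)"
    by (subst (asm) summable_Suc_iff)
  have "(\<Sum>k. (cmod (jacobi_op a b u k))\<^sup>2) = (\<Sum>k. (cmod (jacobi_op a b u (Suc k)))\<^sup>2)"
    using suminf_split_head[OF sJ] by simp
  also have "\<dots> \<le> suminf ?g"
    by (intro suminf_le bd sJ1 sg)
  also have "\<dots> = 3 * C\<^sup>2 * (S + S + (\<Sum>n. (cmod (u (Suc (Suc n))))\<^sup>2))"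
    using su su1 su2 S1
    by (simp add: suminf_mult summable_add suminf_add[symmetric] S_def)
  also have "\<dots> \<le> 3 * C\<^sup>2 * (S + S + S)"
    by (intro mult_left_mono add_left_mono S2) auto
  also have "\<dots> = (3 * C)\<^sup>2 * S"
    by (simp add: power2_eq_square)
  finally have "ell2_norm (jacobi_op a b u) \<le> sqrt ((3 * C)\<^sup>2 * S)"
    unfolding ell2_norm_def by (rule real_sqrt_le_mono)
  also have "\<dots> = 3 * C * ell2_norm u"
    using C0 by (simp add: real_sqrt_mult ell2_norm_def S_def)
  finally show ?thesis
    using sJ by (simp add: ell2_def)
qed

lemmas jacobi_op_ell2 = jacobi_op_bounded_aux[THEN conjunct1]
lemmas jacobi_op_bounded = jacobi_op_bounded_aux[THEN conjunct2]

lemma ell2_inner_summable: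
  assumes "summable (\<lambda>n. (cmod (u n))\<^sup>2)" "summable (\<lambda>n. (cmod (v n))\<^sup>2)"
  shows "summable (\<lambda>n. cnj (u n) * v n)"
proof (rule summable_comparison_test'[OF summable_add[OF assms]])
  fix n
  have "0 \<le> (cmod (u n) - cmod (v n))\<^sup>2" "0 \<le> cmod (u n) * cmod (v n)"
    by simp_all
  then show "norm (cnj (u n) * v n) \<le> (cmod (u n))\<^sup>2 + (cmod (v n))\<^sup>2"
    unfolding norm_mult complex_mod_cnj power2_diff by linarith
qed

lemma jacobi_op_selfadjoint:
  assumes C: "\<And>n. n \<ge> 1 \<Longrightarrow> \<bar>a n\<bar> \<le> C" "\<And>n. n \<ge> 1 \<Longrightarrow> \<bar>b n\<bar> \<le> C"
    and u: "u \<in> ell2" and v: "v \<in> ell2"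
  shows "ell2_inner (jacobi_op a b u) v = ell2_inner u (jacobi_op a b v)"
proof -
  have u0: "u 0 = 0" and su: "summable (\<lambda>n. (cmod (u n))\<^sup>2)"
    using u by (auto simp: ell2_def)
  have v0: "v 0 = 0" and sv: "summable (\<lambda>n. (cmod (v n))\<^sup>2)"
    using v by (auto simp: ell2_def)
  let ?J = "jacobi_op a b"
  have sJ: "summable (\<lambda>n. (cmod (?J u n))\<^sup>2)" "summable (\<lambda>n. (cmod (?J v n))\<^sup>2)"
    using jacobi_op_ell2[OF C u] jacobi_op_ell2[OF C v] by (auto simp: ell2_def)
  let ?f = "\<lambda>n. cnj (?J u n) * v n - cnj (u n) * ?J v n"
  let ?w = "\<lambda>n. a n * (cnj (u (Suc n)) * v n - cnj (u n) * v (Suc n))"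
  have s1: "summable (\<lambda>n. cnj (?J u n) * v n)" and s2: "summable (\<lambda>n. cnj (u n) * ?J v n)"
    using ell2_inner_summable sJ su sv by auto
  have part: "(\<Sum>k<Suc n. ?f k) = ?w n" for n
  proof (induction n)
    case 0
    then show ?case
      using u0 v0 by simp
  next
    case (Suc n)
    have "(\<Sum>k<Suc (Suc n). ?f k) = ?w n + ?f (Suc n)"
      using Suc by simp
    also have "\<dots> = ?w (Suc n)"
      by (simp add: jacobi_op_Suc u0 v0 algebra_simps)
    finally show ?case .
  qed
  have "(\<lambda>n. \<Sum>k<Suc n. ?f k) \<longlonglongrightarrow> suminf ?f"
    using summable_LIMSEQ[OF summable_diff[OF s1 s2]] by (rule LIMSEQ_Suc)
  then have lim: "?w \<longlonglongrightarrow> suminf ?f"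
    unfolding part .
  have tu: "u \<longlonglongrightarrow> 0"
    using summable_LIMSEQ_zero[OF su] by (simp add: tendsto_norm_zero_iff)
  have tv: "v \<longlonglongrightarrow> 0"
    using summable_LIMSEQ_zero[OF sv] by (simp add: tendsto_norm_zero_iff)
  have "(\<lambda>n. C * cmod (cnj (u (Suc n)) * v n - cnj (u n) * v (Suc n))) \<longlonglongrightarrow>
        C * cmod (cnj 0 * 0 - cnj 0 * 0)"
    by (intro tendsto_intros LIMSEQ_Suc tu tv)
  then have t: "(\<lambda>n. C * cmod (cnj (u (Suc n)) * v n - cnj (u n) * v (Suc n))) \<longlonglongrightarrow> 0"
    by simp
  have "?w \<longlonglongrightarrow> 0"
  proof (rule Lim_null_comparison[OF _ t])
    show "\<forall>\<^sub>F n in sequentially. norm (?w n) \<le> C * cmod (cnj (u (Suc n)) * v n - cnj (u n) * v (Suc n))"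
      using eventually_ge_at_top[of 1]
      by eventually_elim (use C(1) in \<open>auto simp: norm_mult intro!: mult_right_mono\<close>)
  qed
  then have "suminf ?f = 0"
    using lim LIMSEQ_unique by blast
  then show ?thesis
    using suminf_diff[OF s1 s2] by (simp add: ell2_inner_def)
qed

end

theory Submission
  imports Defs
begin

text \<open>
  Take $a_n = 1$ throughout and let $b$ be a concatenation of blocks: the $j$-th block has
  height $32/L_j^2$ on $L_j$ sites (a well, for energies above $2$), followed by the opposite
  height on the next $L_j$ sites. The partial sums of $b$ return to $0$ after every block and are
  at most of order $1/L_j$ inside it, so they converge; a block contributes a multiple of
  $L_j^{-3}$ to $\sum_n b_n^2$; and a well of width $L_j$ and depth $32/L_j^2$ is deep enough to
  bind a state at distance of order $L_j^{-2}$ from the band $[-2,2]$, which contributes at least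
  $L_j^{-2q}$ to the eigenvalue sum. For $1 \le q < 3/2$ the choice $L_j \sim j^{1/(2q)}$ makes
  $\sum_j L_j^{-3}$ finite and $\sum_j L_j^{-2q}$ infinite. Smaller $q$ only increases the
  terms, because the eigenvalues used lie in $(2,3]$.

  The wells are not far apart, so eigenvalues are counted rather than located: for
  nondecreasing $L_j \ge 6$ with $\sum_j L_j^{-3} < \infty$ there are at least $j+1$ eigenvalues in $[2 + L_j^{-2}, 3]$ for each $j$
  (\<open>wells_eigenvalues\<close>), and the divergence follows by picking distinct eigenvalues
  greedily (\<open>greedy_sum_bound\<close>). The count is Sturm's oscillation theorem, applied to the
  solution $p_n(E)$ of the eigenvalue equation with $p_0 = 0$, $p_1 = 1$. By comparison
  with a sine, at a suitable energy $E > 2 + L_j^{-2}$ this solution changes sign in each of the wells $0,\dots,j$ (\<open>opoly_sign_change\<close>). Each sign change of $n \mapsto p_n(E)$ forces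
  one more zero of the polynomial $p_N$ above $E$ (\<open>opoly_alternates\<close>). Finally, as
  $N \to \infty$, zeros of $p_N$ that stay away from the band accumulate only at eigenvalues, and
  different zeros have different limits (\<open>eigenvalues_from_roots\<close>).
\<close>

section \<open>The orthogonal polynomials of a Jacobi matrix with unit off-diagonal\<close>

text \<open>
  The value $p_n(x)$ at site $n$ of the formal solution of $Ju = xu$ with $u_0 = 0$ and $u_1 = 1$.
  The degree of $p_n$ is $n - 1$, so the index is shifted by one against the usual numbering of
  orthogonal polynomials.
\<close>

fun opoly :: "(nat \<Rightarrow> real) \<Rightarrow> nat \<Rightarrow> real poly" where
  "opoly b 0 = 0"
| "opoly b (Suc 0) = 1"
| "opoly b (Suc (Suc n)) = [:- b (Suc n), 1:] * opoly b (Suc n) - opoly b n"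

lemma poly_opoly_rec:
  "poly (opoly b (Suc (Suc n))) x = (x - b (Suc n)) * poly (opoly b (Suc n)) x - poly (opoly b n) x"
  by (simp add: algebra_simps)

declare opoly.simps(3) [simp del]

text \<open>
  The confluent case of the Christoffel-Darboux formula. For $n \ge 1$ its right-hand side is positive, which
  ties the sign of $p_{n+1}$ at a zero of $p_n$ to the direction in which $p_n$ crosses zero.
\<close>

lemma opoly_wronskian:
  "poly (pderiv (opoly b (Suc n))) x * poly (opoly b n) x
     - poly (opoly b (Suc n)) x * poly (pderiv (opoly b n)) x
   = (\<Sum>k=1..n. (poly (opoly b k) x)\<^sup>2)"
proof (induction n)
  case (Suc n)
  have d: "poly (pderiv (opoly b (Suc (Suc n)))) x =
      poly (opoly b (Suc n)) x + (x - b (Suc n)) * poly (pderiv (opoly b (Suc n))) x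
        - poly (pderiv (opoly b n)) x"
    by (simp add: opoly.simps(3) pderiv_diff pderiv_mult pderiv_pCons pderiv_add pderiv_smult left_diff_distrib del: mult_pCons_left)
  have "poly (pderiv (opoly b (Suc (Suc n)))) x * poly (opoly b (Suc n)) x
     - poly (opoly b (Suc (Suc n))) x * poly (pderiv (opoly b (Suc n))) x
     = (poly (opoly b (Suc n)) x)\<^sup>2 +
       (poly (pderiv (opoly b (Suc n))) x * poly (opoly b n) x
     - poly (opoly b (Suc n)) x * poly (pderiv (opoly b n)) x)"
    unfolding d poly_opoly_rec by (simp add: algebra_simps power2_eq_square)
  then show ?case
    using Suc by simp
qed simp

lemma opoly_wronskian_pos:
  assumes "n \<ge> 1"
  shows "poly (opoly b (Suc n)) x * poly (pderiv (opoly b n)) x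
           < poly (pderiv (opoly b (Suc n))) x * poly (opoly b n) x"
proof -
  have "(poly (opoly b 1) x)\<^sup>2 \<le> (\<Sum>k=1..n. (poly (opoly b k) x)\<^sup>2)"
    by (rule member_le_sum) (use assms in auto)
  then show ?thesis
    using opoly_wronskian[of b n x] by simp
qed

lemma opoly_neq_0:
  assumes "n \<ge> 1"
  shows "opoly b n \<noteq> 0"
proof
  assume "opoly b n = 0"
  then show False
    using opoly_wronskian_pos[OF assms, of b 0] by simp
qed

text \<open>
  At two different zeros of $p_{n+1}$ the right-hand side vanishes: the corresponding eigenvectors of
  the truncated matrix are orthogonal.
\<close>

lemma christoffel_darboux:
  "(x - y) * (\<Sum>k=1..n. poly (opoly b k) x * poly (opoly b k) y)
   = poly (opoly b (Suc n)) x * poly (opoly b n) y - poly (opoly b n) x * poly (opoly b (Suc n)) y"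
proof (induction n)
  case (Suc n)
  then show ?case
    unfolding poly_opoly_rec sum.atLeastAtMost_shift_bounds
    by (simp add: distrib_left) (simp add: algebra_simps)
qed simp

text \<open>
  If $x - b_n \ge 2$, the recurrence makes the solution convex as long as it is positive, hence it never
  turns back to zero. This bounds the zeros of all $p_n$, $n \ge 1$, from above.
\<close>

lemma opoly_increasing:
  assumes "\<And>n. n \<ge> 1 \<Longrightarrow> b n \<le> x - 2"
  shows "0 < poly (opoly b (Suc n)) x \<and> poly (opoly b n) x \<le> poly (opoly b (Suc n)) x"
proof (induction n)
  case (Suc n)
  have "2 * poly (opoly b (Suc n)) x \<le> (x - b (Suc n)) * poly (opoly b (Suc n)) x"
    using Suc assms[of "Suc n"] by (intro mult_right_mono) auto
  then show ?case
    unfolding poly_opoly_rec using Suc by linarith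
qed simp

section \<open>Sign changes of the solution count zeros above the energy\<close>

text \<open>
  A certificate for at least $m$ zeros of $f$ in $(E, \infty)$: points $t_0 > \dots > t_m = E$ at
  which $f$ has alternating signs, starting with $+$. Ending exactly at $E$ records that the sign of
  $f(E)$ is $(-1)^m$, which is what lets the certificate grow with each sign change.
\<close>

definition alternates :: "(real \<Rightarrow> real) \<Rightarrow> nat \<Rightarrow> real \<Rightarrow> bool" where
  "alternates f m E \<longleftrightarrow>
     (\<exists>t. t m = E \<and> (\<forall>i<m. t (Suc i) < t i) \<and> (\<forall>i\<le>m. (-1) ^ i * f (t i) > 0))"

text \<open>
  The largest zero in the interval works: beyond it the polynomial is positive.
\<close>

lemma poly_upcrossing:
  fixes p :: "real poly"
  assumes uv: "u < v" and u: "poly p u < 0" and v: "poly p v > 0"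
  shows "\<exists>z. u < z \<and> z < v \<and> poly p z = 0 \<and> poly (pderiv p) z \<ge> 0"
proof -
  define R where "R = {z. u < z \<and> z < v \<and> poly p z = 0}"
  have "p \<noteq> 0" using v by auto
  then have fin: "finite R"
    unfolding R_def by (rule finite_subset[rotated, OF poly_roots_finite]) auto
  have "R \<noteq> {}"
    using poly_IVT_pos[OF uv u v] by (auto simp: R_def)
  define z where "z = Max R"
  have z: "u < z" "z < v" "poly p z = 0"
    using Max_in[OF fin \<open>R \<noteq> {}\<close>] by (auto simp: z_def R_def)
  have pos: "poly p y > 0" if "z < y" "y < v" for y
  proof (rule ccontr)
    assume "\<not> poly p y > 0"
    moreover have "poly p y \<noteq> 0"
      using Max_ge[OF fin, of y] that z by (auto simp: R_def z_def)
    ultimately have "poly p y < 0" by simp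
    from poly_IVT_pos[OF that(2) this v] obtain w where "y < w" "w < v" "poly p w = 0" by blast
    then show False
      using Max_ge[OF fin, of w] that z by (auto simp: R_def z_def)
  qed
  have "poly (pderiv p) z \<ge> 0"
  proof (rule ccontr)
    assume "\<not> ?thesis"
    then obtain d where d: "d > 0" "\<And>h. 0 < h \<Longrightarrow> h < d \<Longrightarrow> poly p (z + h) < poly p z"
      using DERIV_neg_dec_right[OF poly_DERIV[of p z]] by auto
    define h where "h = min d (v - z) / 2"
    have "0 < h" "h < d" "z + h < v" using d(1) z by (auto simp: h_def min_def field_simps)
    then show False
      using d(2)[of h] pos[of "z + h"] z by auto
  qed
  then show ?thesis using z by blast
qed

text \<open>
  The induction step of Sturm's theorem. In each gap of the chain for $p_n$ choose a zero at which
  $p_n$ crosses in the direction dictated by the signs at the ends; there the Wronskian inequality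
  gives $p_{n+1}$ the opposite sign. Together with a large first point, where $p_{n+1} > 0$, these
  zeros form a chain for $p_{n+1}$ with signs $+, -, \dots, (-1)^m$ above $E$. If $p_{n+1}(E)$ has
  sign $-(-1)^m$, then $E$ prolongs this chain; otherwise $E$ replaces its last point.
\<close>

lemma opoly_alternates_Suc:
  assumes bd: "\<And>n. n \<ge> 1 \<Longrightarrow> b n \<le> B"
    and n: "n \<ge> 1"
    and nz: "poly (opoly b (Suc n)) E \<noteq> 0"
    and alt: "alternates (poly (opoly b n)) m E"
  shows "alternates (poly (opoly b (Suc n)))
           (if poly (opoly b n) E * poly (opoly b (Suc n)) E < 0 then Suc m else m) E"
proof -
  let ?p = "opoly b n" and ?q = "opoly b (Suc n)"
  obtain t where t: "t m = E" "\<And>i. i < m \<Longrightarrow> t (Suc i) < t i" "\<And>i. i \<le> m \<Longrightarrow> (-1) ^ i * poly ?p (t i) > 0"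
    using alt by (auto simp: alternates_def)
  have "\<exists>z. t (Suc i) < z \<and> z < t i \<and> (-1) ^ Suc i * poly ?q z > 0" if i: "i < m" for i
  proof -
    let ?r = "smult ((-1) ^ i) ?p"
    have "poly ?r (t (Suc i)) < 0" "poly ?r (t i) > 0"
      using t(3)[of i] t(3)[of "Suc i"] i by auto
    from poly_upcrossing[OF t(2)[OF i] this]
    obtain z where z: "t (Suc i) < z" "z < t i" "poly ?p z = 0" "(-1) ^ i * poly (pderiv ?p) z \<ge> 0"
      by (auto simp: pderiv_smult)
    have neg: "poly ?q z * poly (pderiv ?p) z < 0"
      using opoly_wronskian_pos[OF n, of b z] z(3) by simp
    have "(-1) ^ Suc i * poly ?q z > 0"
    proof (cases "even i")
      case True
      then show ?thesis using z(4) neg by (auto simp: mult_less_0_iff)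
    next
      case False
      then show ?thesis using z(4) neg by (auto simp: mult_less_0_iff)
    qed
    then show ?thesis using z by blast
  qed
  then obtain z where z: "\<And>i. i < m \<Longrightarrow> t (Suc i) < z i" "\<And>i. i < m \<Longrightarrow> z i < t i"
      "\<And>i. i < m \<Longrightarrow> (-1) ^ Suc i * poly ?q (z i) > 0"
    by metis
  \<comment> \<open>beyond \<open>B + 2\<close> all the polynomials are positive\<close>
  define T where "T = max (t 0) (B + 2) + 1"
  have T: "poly ?q T > 0"
    using opoly_increasing[of b T n] bd by (force simp: T_def)
  have tT: "t 0 < T" by (auto simp: T_def)
  define s where "s = (\<lambda>i. if i = 0 then T else z (i - 1))"
  have s0: "s 0 = T" and sS: "\<And>i. s (Suc i) = z i" by (auto simp: s_def)
  have s_gt: "t i < s i" if "i \<le> m" for i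
    using that tT z(1)[of "i - 1"] by (cases i) (auto simp: s0 sS)
  have s_dec: "s (Suc i) < s i" if "i < m" for i
    using s_gt[of i] z(2)[of i] that by (simp add: sS)
  have s_sgn: "(-1) ^ i * poly ?q (s i) > 0" if "i \<le> m" for i
    using that z(3)[of "i - 1"] T by (cases i) (auto simp: s0 sS)
  have tdec: "t m \<le> t i" if "i \<le> m" for i
    using that
  proof (induction i rule: inc_induct)
    case (step i)
    then show ?case using t(2)[of i] by auto
  qed auto
  have build: "alternates (poly ?q) k E" if k: "k \<le> Suc m" and "(-1) ^ k * poly ?q E > 0" for k
    unfolding alternates_def
  proof (intro exI[of _ "s(k := E)"] conjI allI impI)
    fix i assume "i < k"
    show "(s(k := E)) (Suc i) < (s(k := E)) i"
    proof (cases "Suc i = k")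
      case True
      then show ?thesis using s_gt[of i] tdec[of i] k t(1) by auto
    qed (use \<open>i < k\<close> k s_dec[of i] in auto)
  next
    fix i assume "i \<le> k"
    then show "(-1) ^ i * poly ?q ((s(k := E)) i) > 0"
      using that s_sgn[of i] by auto
  qed simp
  have "(-1) ^ m * poly ?p E > 0"
    using t(1) t(3)[of m] by auto
  then show ?thesis
    using nz by (intro build) (auto simp: minus_one_power_iff mult_less_0_iff split: if_splits)
qed

lemma opoly_alternates:
  assumes bd: "\<And>n. n \<ge> 1 \<Longrightarrow> b n \<le> B"
    and nz: "\<And>n. n \<ge> 1 \<Longrightarrow> poly (opoly b n) E \<noteq> 0"
  shows "alternates (poly (opoly b (Suc n)))
           (card {k\<in>{1..n}. poly (opoly b k) E * poly (opoly b (Suc k)) E < 0}) E"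
proof (induction n)
  case 0
  then show ?case by (auto simp: alternates_def)
next
  case (Suc n)
  let ?P = "\<lambda>k. poly (opoly b k) E * poly (opoly b (Suc k)) E < 0"
  have "{k\<in>{1..Suc n}. ?P k} = (if ?P (Suc n) then insert (Suc n) {k\<in>{1..n}. ?P k} else {k\<in>{1..n}. ?P k})"
    by (auto simp: le_Suc_eq)
  then have "card {k\<in>{1..Suc n}. ?P k} = (if ?P (Suc n) then Suc (card {k\<in>{1..n}. ?P k}) else card {k\<in>{1..n}. ?P k})"
    by simp
  then show ?case
    using opoly_alternates_Suc[OF bd _ nz Suc] by simp
qed

lemma alternates_roots:
  assumes "alternates (poly p) m E"
  shows "\<exists>z. (\<forall>i<m. E < z i \<and> poly p (z i) = (0::real)) \<and> inj_on z {..<m}"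
proof -
  obtain t where t: "t m = E" "\<And>i. i < m \<Longrightarrow> t (Suc i) < t i" "\<And>i. i \<le> m \<Longrightarrow> (-1) ^ i * poly p (t i) > 0"
    using assms by (auto simp: alternates_def)
  have "\<exists>z. t (Suc i) < z \<and> z < t i \<and> poly p z = 0" if i: "i < m" for i
    using poly_IVT[OF t(2)[OF i], of p] t(3)[of i] t(3)[of "Suc i"] i
    by (auto simp: minus_one_power_iff mult_less_0_iff split: if_splits)
  then obtain z where z: "\<And>i. i < m \<Longrightarrow> t (Suc i) < z i" "\<And>i. i < m \<Longrightarrow> z i < t i"
      "\<And>i. i < m \<Longrightarrow> poly p (z i) = 0"
    by metis
  have tdec: "t j \<le> t i" if "i \<le> j" "j \<le> m" for i j
    using that
  proof (induction i rule: inc_induct)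
    case (step i)
    then show ?case using t(2)[of i] by auto
  qed auto
  have "z j < z i" if "i < j" "j < m" for i j
    using z(2)[of j] z(1)[of i] tdec[of "Suc i" j] that by auto
  then have "inj_on z {..<m}"
    by (metis inj_onI lessThan_iff less_irrefl nat_neq_iff)
  moreover have "E < z i" if "i < m" for i
    using z(1)[OF that] tdec[of "Suc i" m] t(1) that by auto
  ultimately show ?thesis using z(3) by blast
qed

section \<open>Limits of zeros are eigenvalues\<close>

text \<open>
  Past site $M$ the energy exceeds $b_n + 2$ by at least $\eta$, so a solution that vanishes at $N$ must
  decay geometrically on the way to $N$. Induction runs downwards from $N$. The product form of
  the inequality records both the decay and the constancy of the sign, and it survives limits.
\<close>

lemma opoly_decay:
  assumes eta: "\<eta> > 0" and c: "\<And>n. M < n \<Longrightarrow> b n \<le> x - (2 + \<eta>)"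
    and N: "poly (opoly b N) x = 0" and n: "M \<le> n" "n < N"
  shows "(1 + \<eta>) * (poly (opoly b (Suc n)) x)\<^sup>2 \<le> poly (opoly b n) x * poly (opoly b (Suc n)) x"
proof -
  define k where "k = N - 1"
  have k: "N = Suc k" "n \<le> k" using n by (auto simp: k_def)
  show ?thesis
    using k(2) n(1)
  proof (induction rule: inc_induct)
    case base
    then show ?case using N k by simp
  next
    case (step n)
    let ?u = "poly (opoly b (Suc n)) x" and ?v = "poly (opoly b (Suc (Suc n))) x"
    have IH: "(1 + \<eta>) * ?v\<^sup>2 \<le> ?u * ?v" using step by simp
    have "?u * ?v \<le> ?u\<^sup>2"
    proof -
      have "?v\<^sup>2 \<le> ?u * ?v"
        using IH mult_right_mono[of 1 "1 + \<eta>" "?v\<^sup>2"] eta by simp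
      moreover have "0 \<le> (?u - ?v)\<^sup>2" by simp
      ultimately show ?thesis by (simp add: power2_diff)
    qed
    moreover have "(2 + \<eta>) * ?u\<^sup>2 \<le> (x - b (Suc n)) * ?u\<^sup>2"
      using c[of "Suc n"] step.prems by (intro mult_right_mono) auto
    moreover have "poly (opoly b n) x * ?u = (x - b (Suc n)) * ?u\<^sup>2 - ?u * ?v"
      unfolding poly_opoly_rec by (simp add: algebra_simps power2_eq_square)
    ultimately show ?case by (simp add: algebra_simps)
  qed
qed

lemma decay_same_sign:
  fixes u v :: "nat \<Rightarrow> real"
  assumes eta: "\<eta> > 0"
    and u: "\<And>n. M \<le> n \<Longrightarrow> n < N \<Longrightarrow> (1 + \<eta>) * (u (Suc n))\<^sup>2 \<le> u n * u (Suc n)"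
    and v: "\<And>n. M \<le> n \<Longrightarrow> n < N \<Longrightarrow> (1 + \<eta>) * (v (Suc n))\<^sup>2 \<le> v n * v (Suc n)"
    and M: "u M * v M \<ge> 0" and n: "M \<le> n" "n \<le> N"
  shows "u n * v n \<ge> 0"
  using n
proof (induction n rule: dec_induct)
  case (step n)
  show ?case
  proof (cases "u (Suc n) = 0 \<or> v (Suc n) = 0")
    case False
    then have "(1 + \<eta>) * (u (Suc n))\<^sup>2 > 0" "(1 + \<eta>) * (v (Suc n))\<^sup>2 > 0"
      using eta by auto
    then have "u n * u (Suc n) > 0" "v n * v (Suc n) > 0"
      using u[of n] v[of n] step.prems step.hyps by linarith+
    then have "(u n * u (Suc n)) * (v n * v (Suc n)) > 0"
      by (rule mult_pos_pos)
    then have "(u n * v n) * (u (Suc n) * v (Suc n)) > 0"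
      by (simp add: mult_ac)
    then show ?thesis
      using mult_nonneg_nonpos[of "u n * v n" "u (Suc n) * v (Suc n)"] step.IH step.prems step.hyps by linarith
  qed auto
qed (use M in auto)

text \<open>
  The solution is square summable by the ratio test, and $p_1 = 1$ makes it nonzero.
\<close>

lemma jacobi_eigenvalue_of_decay:
  assumes eta: "\<eta> > 0"
    and d: "\<And>n. M \<le> n \<Longrightarrow> (1 + \<eta>) * (poly (opoly b (Suc n)) x)\<^sup>2 \<le> poly (opoly b n) x * poly (opoly b (Suc n)) x"
  shows "jacobi_eigenvalue (\<lambda>_. 1) b (complex_of_real x)"
proof -
  let ?p = "\<lambda>n. poly (opoly b n) x"
  let ?u = "\<lambda>n. complex_of_real (?p n)"
  have "norm ((?p (Suc n))\<^sup>2) \<le> (1 / (1 + \<eta>)) * norm ((?p n)\<^sup>2)" if "M \<le> n" for n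
  proof -
    have 1: "(1 + \<eta>) * \<bar>?p (Suc n)\<bar> \<le> \<bar>?p n\<bar>"
    proof (cases "?p (Suc n) = 0")
      case False
      have "((1 + \<eta>) * \<bar>?p (Suc n)\<bar>) * \<bar>?p (Suc n)\<bar> \<le> \<bar>?p n\<bar> * \<bar>?p (Suc n)\<bar>"
        using d[OF that] by (simp add: mult.assoc power2_eq_square flip: abs_mult)
      then show ?thesis using False by simp
    qed simp
    then have "((1 + \<eta>) * \<bar>?p (Suc n)\<bar>)\<^sup>2 \<le> \<bar>?p n\<bar>\<^sup>2"
      using eta by (intro power_mono) auto
    then have "(1 + \<eta>) * ((1 + \<eta>) * (?p (Suc n))\<^sup>2) \<le> (?p n)\<^sup>2"
      by (simp add: power_mult_distrib) (simp add: power2_eq_square mult_ac)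
    moreover have "1 * ((1 + \<eta>) * (?p (Suc n))\<^sup>2) \<le> (1 + \<eta>) * ((1 + \<eta>) * (?p (Suc n))\<^sup>2)"
      using eta by (intro mult_right_mono) auto
    ultimately have "(1 + \<eta>) * (?p (Suc n))\<^sup>2 \<le> (?p n)\<^sup>2"
      by linarith
    then show ?thesis
      using eta by (simp add: pos_le_divide_eq mult.commute)
  qed
  then have "summable (\<lambda>n. (?p n)\<^sup>2)"
    using eta by (intro summable_ratio_test[of "1 / (1 + \<eta>)" M]) auto
  then have "?u \<in> ell2"
    by (simp add: ell2_def)
  moreover have "?u \<noteq> (\<lambda>n. 0)"
    by (auto dest!: fun_cong[of _ _ 1])
  moreover have "jacobi_op (\<lambda>_. 1) b ?u = (\<lambda>n. complex_of_real x * ?u n)"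
  proof
    fix n
    show "jacobi_op (\<lambda>_. 1) b ?u n = complex_of_real x * ?u n"
    proof (cases n)
      case (Suc k)
      show ?thesis
        unfolding Suc jacobi_op_Suc[of ?u, simplified] poly_opoly_rec
        by (simp add: algebra_simps)
    qed simp
  qed
  ultimately show ?thesis
    unfolding jacobi_eigenvalue_def by blast
qed

lemma common_convergent_subseq:
  fixes z :: "nat \<Rightarrow> nat \<Rightarrow> real"
  assumes "\<And>k i. i < m \<Longrightarrow> z k i \<in> {A..B}"
  shows "\<exists>r l. strict_mono r \<and> (\<forall>i<m. l i \<in> {A..B} \<and> (\<lambda>k. z (r k) i) \<longlonglongrightarrow> l i)"
  using assms
proof (induction m)
  case 0
  show ?case by (intro exI[of _ id]) (auto simp: strict_mono_def)
next
  case (Suc m)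
  have "\<exists>r l. strict_mono r \<and> (\<forall>i<m. l i \<in> {A..B} \<and> (\<lambda>k. z (r k) i) \<longlonglongrightarrow> l i)"
    by (rule Suc.IH, rule Suc.prems) simp
  then obtain r l where r: "strict_mono r" "\<And>i. i < m \<Longrightarrow> l i \<in> {A..B}"
      "\<And>i. i < m \<Longrightarrow> (\<lambda>k. z (r k) i) \<longlonglongrightarrow> l i"
    by blast
  have "\<forall>k. z (r k) m \<in> {A..B}" using Suc.prems by auto
  then obtain y s where s: "y \<in> {A..B}" "strict_mono s" "((\<lambda>k. z (r k) m) \<circ> s) \<longlonglongrightarrow> y"
    using seq_compactE[OF compact_imp_seq_compact[OF compact_Icc], of "\<lambda>k. z (r k) m" A B] by blast
  show ?case
  proof (intro exI[of _ "r \<circ> s"] exI[of _ "l(m := y)"] conjI allI impI)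
    show "strict_mono (r \<circ> s)" using r(1) s(2) by (rule strict_mono_o)
  next
    fix i assume i: "i < Suc m"
    show "(l(m := y)) i \<in> {A..B}" using r s i by (auto simp: less_Suc_eq)
    show "(\<lambda>k. z ((r \<circ> s) k) i) \<longlonglongrightarrow> (l(m := y)) i"
    proof (cases "i = m")
      case True
      then show ?thesis using s by (simp add: o_def)
    next
      case False
      then have "i < m" using i by auto
      from LIMSEQ_subseq_LIMSEQ[OF r(3)[OF this] s(2)] show ?thesis
        using False by (simp add: o_def)
    qed
  qed
qed

text \<open>
  The decay estimate for a zero of $p_N$ has a rate and a starting site $M$ independent of $N$, so
  every limit point of zeros inherits it for all $n \ge M$ and is an eigenvalue. Two different zeros
  $z$, $z'$ of $p_N$ cannot have the same limit $\lambda$: by orthogonality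
  $\sum_{n<N} p_n(z) p_n(z') = 0$, but the part with $n \le M$ tends to
  $\sum_{n \le M} p_n(\lambda)^2 > 0$, while the terms with $n > M$ are nonnegative: close to the
  limit both solutions have the same sign at $M$, and they keep it afterwards.
\<close>

lemma eigenvalues_from_roots:
  assumes b0: "b \<longlonglongrightarrow> 0" and A: "A > 2"
    and roots: "\<And>N. N \<ge> N0 \<Longrightarrow> \<exists>z. (\<forall>i<m. z i \<in> {A..B} \<and> poly (opoly b N) (z i) = 0) \<and> inj_on z {..<m}"
  shows "\<exists>F. card F = m \<and> F \<subseteq> {A..B} \<and> (\<forall>x\<in>F. jacobi_eigenvalue (\<lambda>_. 1) b (complex_of_real x))"
proof -
  define \<eta> where "\<eta> = (A - 2) / 2"
  have eta: "\<eta> > 0" using A by (simp add: \<eta>_def)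
  have "\<forall>\<^sub>F n in sequentially. b n < \<eta>"
    using order_tendstoD(2)[OF b0 eta] .
  then obtain M0 where M0: "\<And>n. n \<ge> M0 \<Longrightarrow> b n < \<eta>"
    by (auto simp: eventually_sequentially)
  define M where "M = Suc M0"
  have bM: "b n \<le> x - (2 + \<eta>)" if "M < n" "x \<ge> A" for n x
    using M0[of n] that by (auto simp: M_def \<eta>_def field_simps)
  have "\<forall>k. \<exists>z. (\<forall>i<m. z i \<in> {A..B} \<and> poly (opoly b (N0 + k)) (z i) = 0) \<and> inj_on z {..<m}"
    using roots by auto
  then obtain z where z: "\<And>k i. i < m \<Longrightarrow> z k i \<in> {A..B}"
      "\<And>k i. i < m \<Longrightarrow> poly (opoly b (N0 + k)) (z k i) = 0" "\<And>k. inj_on (z k) {..<m}"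
    by metis
  from common_convergent_subseq[of m z A B, OF z(1)] obtain r l where r: "strict_mono r"
    and l: "\<And>i. i < m \<Longrightarrow> l i \<in> {A..B}" "\<And>i. i < m \<Longrightarrow> (\<lambda>k. z (r k) i) \<longlonglongrightarrow> l i"
    by blast
  have lim: "(\<lambda>k. poly (opoly b n) (z (r k) i)) \<longlonglongrightarrow> poly (opoly b n) (l i)" if "i < m" for i n
    by (intro tendsto_poly l(2) that)
  have large: "\<forall>\<^sub>F k in sequentially. n < N0 + r k" for n
    using eventually_gt_at_top[of n]
  proof eventually_elim
    case (elim k)
    then show ?case using seq_suble[OF r, of k] by linarith
  qed
  have decay: "(1 + \<eta>) * (poly (opoly b (Suc n)) (z (r k) i))\<^sup>2
      \<le> poly (opoly b n) (z (r k) i) * poly (opoly b (Suc n)) (z (r k) i)"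
    if "i < m" "M \<le> n" "n < N0 + r k" for i n k
    using z(1)[of i "r k"] that by (intro opoly_decay[OF eta bM z(2)]) auto
  have decay_lim: "(1 + \<eta>) * (poly (opoly b (Suc n)) (l i))\<^sup>2 \<le> poly (opoly b n) (l i) * poly (opoly b (Suc n)) (l i)"
    if "i < m" "M \<le> n" for i n
  proof (rule tendsto_le[OF sequentially_bot])
    show "(\<lambda>k. (1 + \<eta>) * (poly (opoly b (Suc n)) (z (r k) i))\<^sup>2) \<longlonglongrightarrow> (1 + \<eta>) * (poly (opoly b (Suc n)) (l i))\<^sup>2"
      by (intro tendsto_intros lim that)
    show "(\<lambda>k. poly (opoly b n) (z (r k) i) * poly (opoly b (Suc n)) (z (r k) i)) \<longlonglongrightarrow>
        poly (opoly b n) (l i) * poly (opoly b (Suc n)) (l i)"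
      by (intro tendsto_intros lim that)
    show "\<forall>\<^sub>F k in sequentially. (1 + \<eta>) * (poly (opoly b (Suc n)) (z (r k) i))\<^sup>2
      \<le> poly (opoly b n) (z (r k) i) * poly (opoly b (Suc n)) (z (r k) i)"
      using large[of n] by eventually_elim (rule decay[OF that])
  qed
  have eig: "jacobi_eigenvalue (\<lambda>_. 1) b (complex_of_real (l i))" if "i < m" for i
    using jacobi_eigenvalue_of_decay[OF eta decay_lim[OF that]] .
  have "inj_on l {..<m}"
  proof (rule inj_onI, rule ccontr)
    fix i j assume ij: "i \<in> {..<m}" "j \<in> {..<m}" "l i = l j" "i \<noteq> j"
    let ?p = "\<lambda>n k i. poly (opoly b n) (z (r k) i)"
    have pM: "poly (opoly b M) (l i) \<noteq> 0"
    proof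
      assume 0: "poly (opoly b M) (l i) = 0"
      have "(1 + \<eta>) * (poly (opoly b (Suc M)) (l i))\<^sup>2 \<le> 0"
        using decay_lim[of i M] ij 0 by simp
      then have "poly (opoly b (Suc M)) (l i) = 0"
        using eta by (simp add: mult_le_0_iff)
      then show False
        using opoly_wronskian_pos[of M b "l i"] 0 by (simp add: M_def)
    qed
    have "(\<lambda>k. ?p M k i * ?p M k j) \<longlonglongrightarrow> poly (opoly b M) (l i) * poly (opoly b M) (l i)"
      using lim[of i M] lim[of j M] ij by (intro tendsto_mult) auto
    then have e1: "\<forall>\<^sub>F k in sequentially. 0 < ?p M k i * ?p M k j"
      by (rule order_tendstoD) (use pM in \<open>auto simp: zero_less_mult_iff\<close>)
    have "(\<lambda>k. \<Sum>n=1..M. ?p n k i * ?p n k j) \<longlonglongrightarrow> (\<Sum>n=1..M. poly (opoly b n) (l i) * poly (opoly b n) (l i))"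
      using lim[of i] lim[of j] ij by (intro tendsto_sum tendsto_mult) auto
    moreover have "(\<Sum>n=1..M. poly (opoly b n) (l i) * poly (opoly b n) (l i)) > 0"
      by (rule sum_pos2[of _ M]) (use pM in \<open>auto simp: zero_less_mult_iff M_def\<close>)
    ultimately have e2: "\<forall>\<^sub>F k in sequentially. 0 < (\<Sum>n=1..M. ?p n k i * ?p n k j)"
      by (rule order_tendstoD)
    obtain k where k: "0 < ?p M k i * ?p M k j" "0 < (\<Sum>n=1..M. ?p n k i * ?p n k j)" "Suc M < N0 + r k"
      using eventually_happens'[OF sequentially_bot eventually_conj[OF e1 eventually_conj[OF e2 large[of "Suc M"]]]]
      by auto
    define N where "N = N0 + r k - 1"
    have N: "N0 + r k = Suc N" "M \<le> N" using k(3) by (auto simp: N_def)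
    have same: "0 \<le> ?p n k i * ?p n k j" if "M \<le> n" "n \<le> N" for n
      by (rule decay_same_sign[where u = "\<lambda>n. ?p n k i" and v = "\<lambda>n. ?p n k j", OF eta decay decay _ that])
        (use k(1) ij N in auto)
    have "(\<Sum>n=1..M. ?p n k i * ?p n k j) \<le> (\<Sum>n=1..N. ?p n k i * ?p n k j)"
      by (rule sum_mono2) (use N same in auto)
    moreover have "(z (r k) i - z (r k) j) * (\<Sum>n=1..N. ?p n k i * ?p n k j) = 0"
      unfolding christoffel_darboux using z(2)[of i "r k"] z(2)[of j "r k"] ij N by simp
    moreover have "z (r k) i \<noteq> z (r k) j"
      using z(3)[of "r k"] ij by (auto simp: inj_on_def)
    ultimately show False using k(2) by simp
  qed
  then have "card (l ` {..<m}) = m"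
    by (simp add: card_image)
  then show ?thesis
    using eig l(1) by (intro exI[of _ "l ` {..<m}"]) auto
qed

section \<open>A deep well forces a sign change\<close>

lemma two_cos_ge: "2 - x\<^sup>2 \<le> 2 * cos (x::real)"
proof -
  have "(sin (x / 2))\<^sup>2 \<le> (x / 2)\<^sup>2"
    using abs_sin_x_le_abs_x[of "x / 2"] unfolding abs_le_square_iff .
  then show ?thesis
    using cos_double_sin[of "x / 2"] by (simp add: power_divide)
qed

text \<open>
  Sturm comparison with $s_j = \sin(j\pi/L)$, the ground state of the interval, whose equation has the
  coefficient $2\cos(\pi/L)$. If $w$ were positive up to $L$, the discrete Wronskian of $s$ and $w$
  would be negative at the left end, could not increase, and would be positive at the right end.
\<close>

lemma sturm_comparison_sin:
  fixes w c :: "nat \<Rightarrow> real"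
  assumes L: "L \<ge> 2"
    and rec: "\<And>j. Suc j < L \<Longrightarrow> w (Suc (Suc j)) = c j * w (Suc j) - w j"
    and c: "\<And>j. Suc j < L \<Longrightarrow> c j \<le> 2 * cos (pi / L)"
    and pos: "\<And>j. j \<le> L \<Longrightarrow> w j > 0"
  shows False
proof -
  define \<theta> where "\<theta> = pi / L"
  define s where "s = (\<lambda>j::nat. sin (real j * \<theta>))"
  have s_rec: "s (Suc (Suc j)) = 2 * cos \<theta> * s (Suc j) - s j" for j
  proof -
    have "s (Suc (Suc j)) = sin (real (Suc j) * \<theta> + \<theta>)" "s j = sin (real (Suc j) * \<theta> - \<theta>)"
      by (simp_all add: s_def algebra_simps)
    then show ?thesis
      by (simp add: s_def sin_add sin_diff)
  qed
  have s_pos: "s j > 0" if "0 < j" "j < L" for j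
  proof -
    have "0 < real j * \<theta>" "real j * \<theta> < pi"
      using that by (auto simp: \<theta>_def field_simps)
    then show ?thesis unfolding s_def by (rule sin_gt_zero)
  qed
  have s0: "s 0 = 0" and sL: "s L = 0"
    using L by (auto simp: s_def \<theta>_def)
  let ?D = "\<lambda>j. s j * w (Suc j) - s (Suc j) * w j"
  have D: "?D j < 0" if "j < L" for j
    using that
  proof (induction j)
    case 0
    then show ?case using s0 s_pos[of 1] pos[of 0] L by simp
  next
    case (Suc j)
    have "?D (Suc j) - ?D j = s (Suc j) * w (Suc j) * (c j - 2 * cos \<theta>)"
      unfolding s_rec rec[OF Suc.prems] by (simp add: algebra_simps)
    moreover have "s (Suc j) * w (Suc j) * (c j - 2 * cos \<theta>) \<le> 0"
      using s_pos[of "Suc j"] pos[of "Suc j"] c[of j] Suc.prems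
      by (intro mult_nonneg_nonpos) (auto simp: \<theta>_def)
    ultimately show ?case using Suc by simp
  qed
  obtain m where m: "L = Suc m" "m > 0" using L by (cases L) auto
  then show False
    using D[of m] sL s_pos[of m] pos[of L] by (auto simp: mult_less_0_iff)
qed

lemma opoly_sign_change:
  fixes L :: nat
  assumes L: "L \<ge> 2"
    and c: "\<And>j. 0 < j \<Longrightarrow> j < L \<Longrightarrow> E - b (n + j) \<le> 2 * cos (pi / L)"
    and nz: "\<And>k. k \<ge> n \<Longrightarrow> poly (opoly b k) E \<noteq> 0"
  shows "\<exists>k. n \<le> k \<and> k < n + L \<and> poly (opoly b k) E * poly (opoly b (Suc k)) E < 0"
proof (rule ccontr)
  assume no: "\<not> ?thesis"
  let ?u = "\<lambda>j. poly (opoly b (n + j)) E"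
  define \<sigma> where "\<sigma> = sgn (?u 0)"
  have pos: "\<sigma> * ?u j > 0" if "j \<le> L" for j
    using that
  proof (induction j)
    case 0
    then show ?case using nz[of n] by (auto simp: \<sigma>_def sgn_if)
  next
    case (Suc j)
    then have "\<not> ?u j * ?u (Suc j) < 0" using no by auto
    moreover have "?u j * ?u (Suc j) \<noteq> 0" using nz[of "n + j"] nz[of "n + Suc j"] by simp
    ultimately have "?u j * ?u (Suc j) > 0" by linarith
    moreover have "\<sigma> * ?u j > 0" using Suc by simp
    ultimately show ?case by (auto simp: zero_less_mult_iff)
  qed
  show False
  proof (rule sturm_comparison_sin[OF L _ _ pos, where c = "\<lambda>j. E - b (n + Suc j)"])
    fix j assume "Suc j < L"
    then show "E - b (n + Suc j) \<le> 2 * cos (pi / L)" using c by blast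
    show "\<sigma> * ?u (Suc (Suc j)) = (E - b (n + Suc j)) * (\<sigma> * ?u (Suc j)) - \<sigma> * ?u j"
      by (simp add: poly_opoly_rec algebra_simps)
  qed
qed

section \<open>The potential\<close>

definition well_start :: "(nat \<Rightarrow> nat) \<Rightarrow> nat \<Rightarrow> nat" where
  "well_start L j = (\<Sum>i<j. 2 * L i)"

definition well_index :: "(nat \<Rightarrow> nat) \<Rightarrow> nat \<Rightarrow> nat" where
  "well_index L k = (LEAST j. k < well_start L (Suc j))"

text \<open>
  Site $n \ge 1$ is the $(n-1)$-st position counted from zero. The height $32/L^2$ is a convenient
  constant $c/L^2$ with $c > \pi^2$, using $\pi < 4$: it leaves a bound state energy above
  $2 + (32 - 16)/L^2$.
\<close>

definition wells :: "(nat \<Rightarrow> nat) \<Rightarrow> nat \<Rightarrow> real" where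
  "wells L n = (let k = n - 1; j = well_index L k in
     if k < well_start L j + L j then 32 / (real (L j))\<^sup>2 else - 32 / (real (L j))\<^sup>2)"

lemma sum_lessThan_split:
  fixes f :: "nat \<Rightarrow> real"
  shows "(\<Sum>k<m + n. f k) = (\<Sum>k<m. f k) + (\<Sum>k<n. f (m + k))"
  by (induction n) (auto simp: add.assoc)

lemma sum_constant_sign_halves:
  fixes l :: nat and x :: real
  shows "(\<Sum>i<2 * l. if i < l then x else - x) = 0"
proof -
  have "(\<Sum>i<l + l. if i < l then x else - x) = 0"
    unfolding sum_lessThan_split by simp
  then show ?thesis by (simp add: mult_2)
qed

context
  fixes L :: "nat \<Rightarrow> nat"
  assumes L6: "\<And>j. L j \<ge> 6"
    and L_mono: "mono L"
    and L_summable: "summable (\<lambda>j. (1 / real (L j)) ^ 3)"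
begin

lemma L_pos: "real (L j) > 0" "L j > 0"
  using L6[of j] by auto

lemma well_start_Suc: "well_start L (Suc j) = well_start L j + 2 * L j"
  by (simp add: well_start_def)

lemma well_start_mono: "i \<le> j \<Longrightarrow> well_start L i \<le> well_start L j"
  unfolding well_start_def by (rule sum_mono2) auto

lemma well_start_ge: "n \<le> well_start L n"
proof (induction n)
  case (Suc n)
  then show ?case using L_pos(2)[of n] by (simp add: well_start_Suc)
qed simp

lemma well_index_bounds:
  "well_start L (well_index L k) \<le> k" "k < well_start L (Suc (well_index L k))"
proof -
  let ?P = "\<lambda>j. k < well_start L (Suc j)"
  have "?P k" using well_start_ge[of "Suc k"] by simp
  then show "?P (well_index L k)"
    unfolding well_index_def by (rule LeastI)
  show "well_start L (well_index L k) \<le> k"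
  proof (cases "well_index L k")
    case (Suc i)
    then have "\<not> ?P i"
      unfolding well_index_def by (intro not_less_Least) simp
    then show ?thesis using Suc by simp
  qed (simp add: well_start_def)
qed

lemma well_index_eq:
  assumes "well_start L j \<le> k" "k < well_start L (Suc j)"
  shows "well_index L k = j"
  using well_index_bounds[of k] assms well_start_mono[of "Suc j" "well_index L k"]
    well_start_mono[of "Suc (well_index L k)" j]
  by (cases "well_index L k" j rule: linorder_cases) auto

lemma wells_value:
  assumes "i < 2 * L j"
  shows "wells L (Suc (well_start L j + i)) = (if i < L j then 32 / (real (L j))\<^sup>2 else - (32 / (real (L j))\<^sup>2))"
proof -
  have "well_index L (well_start L j + i) = j"
    by (rule well_index_eq) (use assms in \<open>auto simp: well_start_Suc\<close>)
  then show ?thesis by (simp add: wells_def)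
qed

lemma wells_le_1: "wells L n \<le> 1"
proof -
  have "wells L n \<le> 32 / (real (L (well_index L (n - 1))))\<^sup>2"
    by (simp add: wells_def Let_def)
  also have "\<dots> \<le> 32 / 6\<^sup>2"
    using L6[of "well_index L (n - 1)"] L_pos by (intro divide_left_mono power_mono mult_pos_pos zero_less_power) auto
  finally show ?thesis by simp
qed

lemma sum_blocks:
  fixes f :: "nat \<Rightarrow> real"
  shows "(\<Sum>k<well_start L j. f k) = (\<Sum>i<j. \<Sum>r<2 * L i. f (well_start L i + r))"
proof (induction j)
  case 0
  then show ?case by (simp add: well_start_def)
next
  case (Suc j)
  then show ?case by (simp add: well_start_Suc sum_lessThan_split)
qed

text \<open>
  A block has $2L$ sites with $b_n^2 = 32^2/L^4$ each.
\<close>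

lemma wells_square_summable: "summable (\<lambda>n. (wells L n)\<^sup>2)"
proof -
  have "summable (\<lambda>k. (wells L (Suc k))\<^sup>2)"
  proof (rule bounded_imp_summable)
    fix n
    have block: "(\<Sum>r<2 * L i. (wells L (Suc (well_start L i + r)))\<^sup>2) = 2048 * (1 / real (L i)) ^ 3" for i
    proof -
      have "(\<Sum>r<2 * L i. (wells L (Suc (well_start L i + r)))\<^sup>2) = (\<Sum>r<2 * L i. (32 / (real (L i))\<^sup>2)\<^sup>2)"
        by (rule sum.cong) (auto simp: wells_value)
      also have "\<dots> = 2048 * (1 / real (L i)) ^ 3"
        using L_pos[of i] by (simp add: field_simps power_divide eval_nat_numeral)
      finally show ?thesis .
    qed
    have "(\<Sum>k\<le>n. (wells L (Suc k))\<^sup>2) \<le> (\<Sum>k<well_start L (Suc n). (wells L (Suc k))\<^sup>2)"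
      using well_start_ge[of "Suc n"] by (intro sum_mono2) auto
    also have "\<dots> = (\<Sum>i<Suc n. 2048 * (1 / real (L i)) ^ 3)"
      unfolding sum_blocks block ..
    also have "\<dots> \<le> (\<Sum>i. 2048 * (1 / real (L i)) ^ 3)"
      by (rule sum_le_suminf) (auto intro: summable_mult L_summable)
    finally show "(\<Sum>k\<le>n. (wells L (Suc k))\<^sup>2) \<le> (\<Sum>i. 2048 * (1 / real (L i)) ^ 3)" .
  qed auto
  then show ?thesis by (subst (asm) summable_Suc_iff)
qed

lemma wells_tendsto_0: "wells L \<longlonglongrightarrow> 0"
  using summable_LIMSEQ_zero[OF wells_square_summable] by (simp add: power_tendsto_0_iff)

text \<open>
  Complete blocks cancel, so only the current block contributes.
\<close>

lemma wells_partial_sum_bound: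
  "\<bar>\<Sum>k<n. wells L (Suc k)\<bar> \<le> 64 * (1 / real (L (well_index L n)))"
proof -
  define j where "j = well_index L n"
  define i where "i = n - well_start L j"
  have n: "n = well_start L j + i" "i < 2 * L j"
    using well_index_bounds[of n] by (auto simp: i_def j_def well_start_Suc)
  have "(\<Sum>k<well_start L j. wells L (Suc k)) = (\<Sum>i<j. \<Sum>r<2 * L i. if r < L i then 32 / (real (L i))\<^sup>2 else - (32 / (real (L i))\<^sup>2))"
    unfolding sum_blocks by (intro sum.cong) (auto simp: wells_value)
  also have "\<dots> = 0"
    unfolding sum_constant_sign_halves by simp
  finally have "\<bar>\<Sum>k<n. wells L (Suc k)\<bar> = \<bar>\<Sum>r<i. wells L (Suc (well_start L j + r))\<bar>"
    by (simp add: n(1) sum_lessThan_split)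
  also have "\<dots> \<le> (\<Sum>r<i. \<bar>wells L (Suc (well_start L j + r))\<bar>)"
    by (rule sum_abs)
  also have "\<dots> = (\<Sum>r<i. 32 / (real (L j))\<^sup>2)"
    using n(2) by (intro sum.cong) (auto simp: wells_value)
  also have "\<dots> \<le> real (2 * L j) * (32 / (real (L j))\<^sup>2)"
    using n(2) by (simp add: mult_right_mono divide_right_mono)
  also have "\<dots> = 64 * (1 / real (L j))"
    using L_pos[of j] by (simp add: power2_eq_square)
  finally show ?thesis unfolding j_def .
qed

lemma wells_sum_tendsto: "(\<lambda>n. \<Sum>j=1..n. wells L j) \<longlonglongrightarrow> 0"
proof -
  have "(\<lambda>j. 1 / real (L j)) \<longlonglongrightarrow> 0"
    using summable_LIMSEQ_zero[OF L_summable] by (subst (asm) power_tendsto_0_iff) auto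
  moreover have "filterlim (well_index L) sequentially sequentially"
    unfolding filterlim_at_top eventually_sequentially
  proof (intro allI exI impI)
    fix J n assume "n \<ge> well_start L J"
    then show "J \<le> well_index L n"
      using well_index_bounds(2)[of n] well_start_mono[of "Suc (well_index L n)" J] by linarith
  qed
  ultimately have "(\<lambda>n. 1 / real (L (well_index L n))) \<longlonglongrightarrow> 0"
    by (rule filterlim_compose)
  then have "(\<lambda>n. 64 * (1 / real (L (well_index L n)))) \<longlonglongrightarrow> 0"
    by (rule tendsto_mult_right_zero)
  then have "(\<lambda>n. \<Sum>k<n. wells L (Suc k)) \<longlonglongrightarrow> 0"
    by (rule Lim_null_comparison[rotated]) (auto intro!: always_eventually wells_partial_sum_bound[simplified])
  then show ?thesis
    by (simp add: sum.atLeast1_atMost_eq)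
qed

text \<open>
  Since $L_i \le L_j$, the energy satisfies $E - 32/L_i^2 \le 2 - 16/L_i^2 \le 2\cos(\pi/L_i)$ in
  well $i$.
\<close>

lemma wells_sign_change:
  assumes nz: "\<And>n. n \<ge> 1 \<Longrightarrow> poly (opoly (wells L) n) E \<noteq> 0"
    and E: "E \<le> 2 + 16 / (real (L j))\<^sup>2" and i: "i \<le> j"
  shows "\<exists>k. well_start L i < k \<and> k \<le> well_start L i + L i \<and>
     poly (opoly (wells L) k) E * poly (opoly (wells L) (Suc k)) E < 0"
proof -
  have "\<exists>k. Suc (well_start L i) \<le> k \<and> k < Suc (well_start L i) + L i \<and>
     poly (opoly (wells L) k) E * poly (opoly (wells L) (Suc k)) E < 0"
  proof (rule opoly_sign_change)
    show "2 \<le> L i" using L6[of i] by simp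
    show "poly (opoly (wells L) k) E \<noteq> 0" if "Suc (well_start L i) \<le> k" for k
      using nz[of k] that by simp
  next
    fix r assume r: "0 < r" "r < L i"
    have "E \<le> 2 + 16 / (real (L i))\<^sup>2"
    proof -
      have "16 / (real (L j))\<^sup>2 \<le> 16 / (real (L i))\<^sup>2"
        using monoD[OF L_mono i] L_pos[of i] by (intro divide_left_mono power_mono) auto
      then show ?thesis using E by linarith
    qed
    moreover have "wells L (Suc (well_start L i) + r) = 32 / (real (L i))\<^sup>2"
      using wells_value[of r i] r by simp
    ultimately have "E - wells L (Suc (well_start L i) + r) \<le> 2 - 16 / (real (L i))\<^sup>2"
      by simp
    also have "\<dots> \<le> 2 - (pi / L i)\<^sup>2"
    proof -
      have "pi\<^sup>2 \<le> 4\<^sup>2" using pi_less_4 pi_gt_zero by (intro power_mono) auto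
      then show ?thesis by (simp add: power_divide divide_right_mono)
    qed
    also have "\<dots> \<le> 2 * cos (pi / L i)" by (rule two_cos_ge)
    finally show "E - wells L (Suc (well_start L i) + r) \<le> 2 * cos (pi / L i)" .
  qed
  then show ?thesis by (auto simp: Suc_le_eq less_Suc_eq_le)
qed

text \<open>
  The energy $E$ is chosen in $(2 + L_j^{-2}, 2 + 16 L_j^{-2})$, off the countably many zeros of the
  $p_n$ so that signs are defined. The wells $0,\dots,j$ then give $j + 1$ sign changes at different
  sites, hence $j + 1$ zeros above $E$ of every later $p_N$. These zeros lie below $3$ because
  $b_n \le 1$.
\<close>

lemma wells_eigenvalues:
  "\<exists>F. card F = Suc j \<and> F \<subseteq> {2 + 1 / (real (L j))\<^sup>2..3} \<and>
     (\<forall>x\<in>F. jacobi_eigenvalue (\<lambda>_. 1) (wells L) (complex_of_real x))"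
proof -
  let ?p = "\<lambda>n. poly (opoly (wells L) n)"
  have "countable (\<Union>n\<in>{1..}. {x. ?p n x = 0})"
    by (rule countable_UN) (simp, intro countable_finite poly_roots_finite opoly_neq_0, simp)
  moreover have "uncountable {2 + 1 / (real (L j))\<^sup>2<..<2 + 16 / (real (L j))\<^sup>2}"
    using L_pos[of j] by (simp add: uncountable_open_interval divide_strict_right_mono)
  ultimately have "\<not> {2 + 1 / (real (L j))\<^sup>2<..<2 + 16 / (real (L j))\<^sup>2} \<subseteq> (\<Union>n\<in>{1..}. {x. ?p n x = 0})"
    using countable_subset by blast
  then obtain E where E: "2 + 1 / (real (L j))\<^sup>2 < E" "E < 2 + 16 / (real (L j))\<^sup>2"
    and nz: "\<And>n. n \<ge> 1 \<Longrightarrow> ?p n E \<noteq> 0"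
    by (auto simp: subset_iff)
  have "0 < 1 / (real (L j))\<^sup>2" using L_pos[of j] by simp
  with E(1) have E2: "E > 2" by linarith
  define S where "S = (\<lambda>N. {k\<in>{1..N}. ?p k E * ?p (Suc k) E < 0})"
  have count: "Suc j \<le> card (S N)" if N: "N \<ge> well_start L (Suc j)" for N
  proof -
    have "\<exists>k. well_start L i < k \<and> k \<le> well_start L i + L i \<and> ?p k E * ?p (Suc k) E < 0" if "i \<le> j" for i
      using wells_sign_change[OF nz _ that] E(2) by simp
    then obtain k where k: "\<And>i. i \<le> j \<Longrightarrow> well_start L i < k i" "\<And>i. i \<le> j \<Longrightarrow> k i \<le> well_start L i + L i"
      "\<And>i. i \<le> j \<Longrightarrow> ?p (k i) E * ?p (Suc (k i)) E < 0"
      by metis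
    have k_le: "k i \<le> well_start L i'" if "i < i'" "i \<le> j" for i i'
      using k(2)[OF that(2)] well_start_mono[of "Suc i" i'] that(1) by (simp add: well_start_Suc)
    have "k i < k i'" if "i < i'" "i' \<le> j" for i i'
      using k_le[of i i'] k(1)[of i'] that by simp
    then have "inj_on k {..j}"
      by (metis inj_onI atMost_iff less_irrefl nat_neq_iff)
    moreover have "k ` {..j} \<subseteq> S N"
    proof clarify
      fix i assume "i \<le> j"
      then show "k i \<in> S N"
        using k_le[of i "Suc j"] k(1)[of i] k(3)[of i] N by (simp add: S_def)
    qed
    ultimately have "card {..j} \<le> card (S N)"
      by (rule card_inj_on_le) (simp add: S_def)
    then show ?thesis by simp
  qed
  have "\<exists>F. card F = Suc j \<and> F \<subseteq> {E..3} \<and> (\<forall>x\<in>F. jacobi_eigenvalue (\<lambda>_. 1) (wells L) (complex_of_real x))"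
  proof (rule eigenvalues_from_roots[OF wells_tendsto_0 E2])
    fix N assume "N \<ge> Suc (well_start L (Suc j))"
    then obtain N' where N': "N = Suc N'" "N' \<ge> well_start L (Suc j)"
      by (cases N) auto
    have "alternates (?p N) (card (S N')) E"
      unfolding N'(1) S_def by (rule opoly_alternates[OF wells_le_1 nz])
    from alternates_roots[OF this] obtain z
      where z: "\<And>i. i < card (S N') \<Longrightarrow> E < z i \<and> ?p N (z i) = 0" "inj_on z {..<card (S N')}"
      by blast
    have "z i < 3" if "i < card (S N')" for i
    proof (rule ccontr)
      assume "\<not> z i < 3"
      then have "?p (Suc N') (z i) > 0"
        using order_trans[OF wells_le_1, of "z i - 2"] by (intro opoly_increasing[THEN conjunct1]) simp
      then show False using z(1)[OF that] N' by simp
    qed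
    then show "\<exists>z. (\<forall>i<Suc j. z i \<in> {E..3} \<and> ?p N (z i) = 0) \<and> inj_on z {..<Suc j}"
      using z count[OF N'(2)]
      by (intro exI[of _ z] conjI inj_on_subset[OF z(2)] allI impI) (auto simp: less_imp_le)
  qed
  then show ?thesis
    using E(1) by (fastforce dest: subsetD)
qed

end

section \<open>Divergence of the eigenvalue sum\<close>

text \<open>
  Among $n + 1$ points where $f \ge w_n$ there is one that has not been used for $w_0, \dots, w_{n-1}$.
\<close>

lemma greedy_sum_bound:
  fixes f :: "'a \<Rightarrow> real"
  assumes many: "\<And>j. \<exists>F\<subseteq>S. card F = Suc j \<and> (\<forall>x\<in>F. w j \<le> f x)"
  shows "\<exists>G\<subseteq>S. finite G \<and> card G = n \<and> (\<Sum>j<n. w j) \<le> sum f G"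
proof (induction n)
  case 0
  show ?case by (intro exI[of _ "{}"]) auto
next
  case (Suc n)
  then obtain G where G: "G \<subseteq> S" "finite G" "card G = n" "(\<Sum>j<n. w j) \<le> sum f G"
    by blast
  obtain F where F: "F \<subseteq> S" "card F = Suc n" "\<And>x. x \<in> F \<Longrightarrow> w n \<le> f x"
    using many[of n] by blast
  have "\<not> F \<subseteq> G"
    using card_mono[OF G(2), of F] F(2) G(3) by auto
  then obtain x where "x \<in> F" "x \<notin> G" by blast
  then show ?case
    using G F by (intro exI[of _ "insert x G"]) (auto simp: add_mono add.commute)
qed

lemma infsum_ennreal_eq_infinity:
  fixes f :: "'a \<Rightarrow> real"
  assumes f: "\<And>x. f x \<ge> 0" and w: "\<And>j. w j \<ge> 0" "\<not> summable w"
    and many: "\<And>j. \<exists>F\<subseteq>S. card F = Suc j \<and> (\<forall>x\<in>F. w j \<le> f x)"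
  shows "(\<Sum>\<^sub>\<infinity>x\<in>S. ennreal (f x)) = \<infinity>"
proof (rule ccontr)
  assume "\<not> ?thesis"
  then obtain C where C: "(\<Sum>\<^sub>\<infinity>x\<in>S. ennreal (f x)) = ennreal C" "C \<ge> 0"
    by (metis ennreal_cases infinity_ennreal_def)
  have "(\<Sum>j<n. w j) \<le> C" for n
  proof -
    obtain G where G: "G \<subseteq> S" "finite G" "(\<Sum>j<n. w j) \<le> sum f G"
      using greedy_sum_bound[of S w f n, OF many] by blast
    have "ennreal (sum f G) = (\<Sum>x\<in>G. ennreal (f x))"
      using f by (simp add: sum_ennreal)
    also have "\<dots> = (\<Sum>\<^sub>\<infinity>x\<in>G. ennreal (f x))"
      using G(2) by simp
    also have "\<dots> \<le> ennreal C"
      unfolding C(1)[symmetric] using G(1) by (intro infsum_mono_neutral) (auto intro: nonneg_summable_on_complete)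
    finally show ?thesis using G(3) C(2) by simp
  qed
  then have "summable w"
    using w(1) by (intro summableI_nonneg_bounded)
  then show False using w(2) by blast
qed

theorem theorem9p2:
  fixes q :: real
  assumes "q < 3 / 2"
  shows "\<exists>a b :: nat \<Rightarrow> real.
           (\<forall>n\<ge>1. a n > 0) \<and>
           (\<lambda>n. \<bar>a n - 1\<bar>\<^sup>2 + \<bar>b n\<bar>\<^sup>2) summable_on {1..} \<and>
           (\<exists>L. L \<noteq> 0 \<and> (\<lambda>n. \<Prod>j=1..n. a j) \<longlonglongrightarrow> L) \<and>
           convergent (\<lambda>n. \<Sum>j=1..n. b j) \<and>
           (\<Sum>\<^sub>\<infinity>E\<in>eigs_plus a b \<union> eigs_minus a b. ennreal ((\<bar>E\<bar> - 2) powr q)) = \<infinity>"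
proof -
  \<comment> \<open>the construction is run with the exponent \<open>r\<close>; the terms for \<open>q\<close> dominate those for \<open>r\<close>
    as the eigenvalues used are within distance 1 of the band\<close>
  define r where "r = max q 1"
  have r: "q \<le> r" "1 \<le> r" "r < 3 / 2" using assms by (auto simp: r_def)
  define s where "s = 1 / (2 * r)"
  have s: "s > 0" "2 * s * r = 1" "3 * s > 1" using r by (auto simp: s_def field_simps)
  \<comment> \<open>the offset 6 makes \<open>b n \<le> 32/36 \<le> 1\<close>\<close>
  define L where "L = (\<lambda>j. 6 + nat \<lfloor>(real j + 1) powr s\<rfloor>)"
  have L6: "L j \<ge> 6" for j by (simp add: L_def)
  have L_mono: "mono L"
    unfolding L_def by (intro monoI add_left_mono nat_mono floor_mono powr_mono2) (use s in auto)
  have L_lower: "(real j + 1) powr s \<le> real (L j)" for j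
    unfolding L_def by (simp add: of_nat_nat) linarith
  have L_upper: "real (L j) \<le> 7 * (real j + 1) powr s" for j
  proof -
    have "1 \<le> (real j + 1) powr s" using s by (simp add: ge_one_powr_ge_zero)
    then show ?thesis unfolding L_def by (simp add: of_nat_nat) linarith
  qed
  have "summable (\<lambda>j. real (Suc j) powr (- (3 * s)))"
    using s(3) by (subst summable_Suc_iff) (simp add: summable_real_powr_iff)
  then have L_summable: "summable (\<lambda>j. (1 / real (L j)) ^ 3)"
  proof (rule summable_comparison_test'[where N = 0])
    fix j :: nat
    have "(1 / real (L j)) ^ 3 \<le> (1 / (real j + 1) powr s) ^ 3"
      using L_lower[of j] L6[of j] by (intro power_mono divide_left_mono) auto
    also have "\<dots> = real (Suc j) powr (- (3 * s))"
      by (simp add: powr_minus power_divide powr_power field_simps add.commute)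
    finally show "norm ((1 / real (L j)) ^ 3) \<le> real (Suc j) powr (- (3 * s))"
      by simp
  qed
  define b where "b = wells L"
  define w where "w = (\<lambda>j. (1 / (real (L j))\<^sup>2) powr r)"
  have w_not_summable: "\<not> summable w"
  proof
    assume "summable w"
    then have "summable (\<lambda>j. 49 powr r * w j)" by (rule summable_mult)
    then have "summable (\<lambda>j. 1 / real (Suc j))"
    proof (rule summable_comparison_test'[where N = 0])
      fix j :: nat
      have "(real (L j))\<^sup>2 powr r \<le> ((7 * (real j + 1) powr s)\<^sup>2) powr r"
        using L_upper[of j] r by (intro powr_mono2 power_mono) auto
      also have "\<dots> = 49 powr r * ((real j + 1) powr (2 * s)) powr r"
        by (simp add: power_mult_distrib powr_mult powr_power mult.commute)
      also have "\<dots> = 49 powr r * real (Suc j)"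
        using s(2) by (simp add: powr_powr add.commute)
      finally show "norm (1 / real (Suc j)) \<le> 49 powr r * w j"
        using L6[of j] by (simp add: w_def powr_divide field_simps)
    qed
    then show False
      using not_summable_harmonic[where 'a = real]
      by (subst (asm) summable_Suc_iff) (simp add: inverse_eq_divide)
  qed
  have many: "\<exists>F\<subseteq>eigs_plus (\<lambda>_. 1) b \<union> eigs_minus (\<lambda>_. 1) b. card F = Suc j \<and>
      (\<forall>x\<in>F. w j \<le> (\<bar>x\<bar> - 2) powr q)" for j
  proof -
    obtain F where F: "card F = Suc j" "F \<subseteq> {2 + 1 / (real (L j))\<^sup>2..3}"
        "\<And>x. x \<in> F \<Longrightarrow> jacobi_eigenvalue (\<lambda>_. 1) b (complex_of_real x)"
      using wells_eigenvalues[OF L6 L_mono L_summable, of j] unfolding b_def by auto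
    have pos: "0 < 1 / (real (L j))\<^sup>2" using L6[of j] by simp
    have gt2: "x > 2" if "x \<in> F" for x
    proof -
      have "2 + 1 / (real (L j))\<^sup>2 \<le> x" using F(2) that by auto
      then show ?thesis using pos by linarith
    qed
    have "w j \<le> (\<bar>x\<bar> - 2) powr q" if "x \<in> F" for x
    proof -
      have x: "2 + 1 / (real (L j))\<^sup>2 \<le> x" "x \<le> 3" using F(2) that by auto
      have "w j \<le> (x - 2) powr r"
        unfolding w_def using x r by (intro powr_mono2) auto
      also have "\<dots> \<le> (x - 2) powr q"
        using x gt2[OF that] r by (intro powr_mono') auto
      finally show ?thesis using gt2[OF that] by simp
    qed
    moreover have "F \<subseteq> eigs_plus (\<lambda>_. 1) b"
      using F(3) gt2 by (auto simp: eigs_plus_def)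
    ultimately show ?thesis using F(1) by blast
  qed
  show ?thesis
  proof (rule exI[of _ "\<lambda>_. 1"], rule exI[of _ b], intro conjI)
    have "(\<lambda>n. (b n)\<^sup>2) summable_on UNIV"
      using wells_square_summable[OF L6 L_mono L_summable]
      by (simp add: b_def summable_on_UNIV_nonneg_real_iff)
    then show "(\<lambda>n. \<bar>1 - 1 :: real\<bar>\<^sup>2 + \<bar>b n\<bar>\<^sup>2) summable_on {1..}"
      by (auto intro: summable_on_subset_banach)
    show "\<exists>P. P \<noteq> 0 \<and> (\<lambda>n::nat. \<Prod>j=1..n. 1 :: real) \<longlonglongrightarrow> P"
      by (intro exI[of _ 1]) simp
    show "convergent (\<lambda>n. \<Sum>j=1..n. b j)"
      using wells_sum_tendsto[OF L6 L_mono L_summable] by (auto simp: b_def convergent_def)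
    show "(\<Sum>\<^sub>\<infinity>E\<in>eigs_plus (\<lambda>_. 1) b \<union> eigs_minus (\<lambda>_. 1) b. ennreal ((\<bar>E\<bar> - 2) powr q)) = \<infinity>"
      by (rule infsum_ennreal_eq_infinity[OF _ _ w_not_summable many]) (auto simp: w_def)
  qed auto
qed

end
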